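(* (1) If $\mathbb{F}$ is any subfield of $\mathbb{R}$ and $f\colon\mathbb{F}\to\mathbb{F}$ is a continuous SD map, then $f$ is the identity map. (2) If $\mathbb{F}$ is any subfield of $\mathbb{C}$ containing the Gaussian rationals $\mathbb{Q}(i)$ and $f\colon\mathbb{F}\to\mathbb{F}$ is a continuous SD map, then $f(z)=z$ for all $z\in\mathbb{F}$ or $f(z)=\overline{z}$ for all $z\in\mathbb{F}$.
   Context: An SD map on a field $\mathbb{F}$ is a function $f\colon \mathbb{F}\to\mathbb{F}$ such that for all $x \neq y$ in $\mathbb{F}$ one has $f(x)\neq f(y)$ and $f\left(\frac{x+y}{x-y}\right) = \frac{f(x)+f(y)}{f(x)-f(y)}$. Continuity is with respect to the usual topology inherited from $\mathbb{R}$ or $\mathbb{C}$. *)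

theory Defs
  imports "HOL-Analysis.Analysis" "HOL-Algebra.Algebraic_Closure_Type"
begin

text \<open>
  A field \<open>F\<close> inside an ambient field type is given by its carrier set; only the values of \<open>f\<close> on
  \<open>F\<close> matter.
\<close>

definition SD_map_on :: "'a::field set \<Rightarrow> ('a \<Rightarrow> 'a) \<Rightarrow> bool" where
  "SD_map_on F f \<longleftrightarrow>
     f \<in> F \<rightarrow> F \<and>
     (\<forall>x\<in>F. \<forall>y\<in>F. x \<noteq> y \<longrightarrow>
        f x \<noteq> f y \<and> f ((x + y) / (x - y)) = (f x + f y) / (f x - f y))"

text \<open>
  The library's \<^const>\<open>ring_of_type_algebra\<close> is the type \<open>'a\<close> with its type class operations, viewed
  as a \<open>HOL-Algebra\<close> ring.
\<close>

abbreviation is_subfield :: "'a::field set \<Rightarrow> bool" where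
  "is_subfield F \<equiv> subfield F (ring_of_type_algebra :: 'a ring)"

lemma is_subfield_iff:
  fixes F :: "'a::field set"
  shows "is_subfield F \<longleftrightarrow>
    0 \<in> F \<and> 1 \<in> F \<and> (\<forall>x\<in>F. \<forall>y\<in>F. x + y \<in> F \<and> x * y \<in> F) \<and>
    (\<forall>x\<in>F. - x \<in> F \<and> inverse x \<in> F)" (is "?L \<longleftrightarrow> ?R")
proof -
  define R where "R = (ring_of_type_algebra :: 'a ring)"
  interpret R: field R unfolding R_def by (rule field_from_type_algebra)
  have sel [simp]: "carrier R = UNIV" "\<zero>\<^bsub>R\<^esub> = 0" "\<one>\<^bsub>R\<^esub> = 1"
    "x \<oplus>\<^bsub>R\<^esub> y = x + y" "x \<otimes>\<^bsub>R\<^esub> y = x * y" for x y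
    by (simp_all add: R_def ring_of_type_algebra_def)
  have neg [simp]: "\<ominus>\<^bsub>R\<^esub> x = - x" for x
    by (rule R.minus_equality) auto
  have inv [simp]: "inv\<^bsub>R\<^esub> x = inverse x" if "x \<noteq> 0" for x
    using that by (intro R.comm_inv_char) auto
  have "subfield F R \<longleftrightarrow> ?R"
  proof
    assume *: "subfield F R"
    then have sr: "subring F R"
      using subcring.axioms(1) subdomain.axioms(1) subfield.axioms(1) by blast
    have "inverse x \<in> F" if "x \<in> F" for x
      using R.subfield_m_inv(1)[OF *, of x] that subringE(2)[OF sr] by (cases "x = 0") auto
    then show ?R
      using subringE[OF sr] by auto
  next
    assume ?R
    then show "subfield F R"
      by (intro R.subfieldI' R.subringI) auto
  qed
  then show ?thesis by (simp add: R_def)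
qed

definition gaussian_rationals :: "complex set" where
  "gaussian_rationals = {a + b * \<i> | a b. a \<in> \<rat> \<and> b \<in> \<rat>}"

end

theory Submission
  imports Defs
begin

text \<open>
  An SD map fixes \<open>0\<close> and \<open>1\<close> and is multiplicative, because its functional equation expresses
  \<open>f x / f y\<close> through \<open>x / y\<close> alone. With \<open>y = 1\<close> the equation becomes a recurrence for \<open>f (t + 1)\<close>;
  computing \<open>f 6\<close> from it and as \<open>f 2 * f 3\<close> shows that \<open>a = f 2\<close> satisfies
  \<open>(a - 2) * (a\<^sup>2 + 1) = 0\<close>. If \<open>a\<^sup>2 = -1\<close>, then \<open>f (1 / 2 ^ n)\<close> has norm \<open>1\<close>, contradicting continuity
  at \<open>0\<close>. Hence \<open>f 2 = 2\<close>, the recurrence makes \<open>f\<close> the identity on \<open>\<rat>\<close>, and density settles the real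
  case.

  In the complex case \<open>f \<i> = \<plusminus>\<i>\<close>, and after composing with conjugation \<open>f \<i> = \<i>\<close>. For \<open>z = r + s * \<i>\<close> with
  rational \<open>r\<close>, \<open>s\<close>, the functional equation gives the quotient of \<open>f z\<close> and \<open>f (cnj z)\<close>, while
  multiplicativity gives their product, so \<open>f z = \<plusminus>z\<close>. If \<open>f z = -z\<close>, comparing the signs at
  \<open>z - 1\<close>, \<open>z\<close> and \<open>z + 1\<close> yields \<open>(z + 1)\<^sup>2 = \<plusminus>(z - 1)\<^sup>2\<close>, that is, \<open>z\<close> is \<open>0\<close> or \<open>\<plusminus>\<i>\<close>.
  So \<open>f\<close> is the identity on the dense set \<open>\<rat>(\<i>)\<close>.
\<close>

text \<open>
  \<open>f\<close> is not required to map \<open>F\<close> into itself, so that the locale is stable under composition with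
  conjugation.
\<close>

locale continuous_SD_map =
  fixes F :: "'a::real_normed_field set" and f :: "'a \<Rightarrow> 'a"
  assumes is_subfield: "is_subfield F"
    and continuous: "continuous_on F f"
    and inj: "\<lbrakk>x \<in> F; y \<in> F; x \<noteq> y\<rbrakk> \<Longrightarrow> f x \<noteq> f y"
    and SD: "\<lbrakk>x \<in> F; y \<in> F; x \<noteq> y\<rbrakk> \<Longrightarrow> f ((x + y) / (x - y)) = (f x + f y) / (f x - f y)"
begin

section \<open>Closure of the carrier under the field operations\<close>

lemma closed_zero [simp]: "0 \<in> F"
  and closed_one [simp]: "1 \<in> F"
  and closed_add: "\<lbrakk>x \<in> F; y \<in> F\<rbrakk> \<Longrightarrow> x + y \<in> F"
  and closed_mult: "\<lbrakk>x \<in> F; y \<in> F\<rbrakk> \<Longrightarrow> x * y \<in> F"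
  and closed_minus: "x \<in> F \<Longrightarrow> - x \<in> F"
  and closed_inverse: "x \<in> F \<Longrightarrow> inverse x \<in> F"
  using is_subfield unfolding is_subfield_iff by auto

lemma closed_diff: "\<lbrakk>x \<in> F; y \<in> F\<rbrakk> \<Longrightarrow> x - y \<in> F"
  using closed_add[of x "- y"] closed_minus by simp

lemma closed_divide: "\<lbrakk>x \<in> F; y \<in> F\<rbrakk> \<Longrightarrow> x / y \<in> F"
  by (simp add: divide_inverse closed_mult closed_inverse)

lemma closed_of_nat [simp]: "of_nat n \<in> F"
  by (induction n) (auto intro: closed_add)

lemma closed_numeral [simp]: "numeral n \<in> F"
  using closed_of_nat[of "numeral n"] by simp

lemma closed_Rats: "x \<in> \<rat> \<Longrightarrow> x \<in> F"
proof (induction rule: Rats_cases')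
  case (1 a b)
  have "of_int a \<in> F" for a
    by (cases a rule: int_cases2) (auto intro: closed_minus)
  then show ?case
    using 1 closed_divide by simp
qed

lemmas closed = closed_add closed_mult closed_minus closed_inverse closed_diff closed_divide

section \<open>Special values and multiplicativity\<close>

lemma map_zero [simp]: "f 0 = 0"
proof (rule ccontr)
  assume c: "f 0 \<noteq> 0"
  \<comment> \<open>For \<open>c \<noteq> 0\<close> the map
    \<open>u \<mapsto> (u + c) / (u - c)\<close> is injective, yet with \<open>c = f 0\<close> it
    would send both \<open>f 1\<close> and \<open>f 2\<close> to \<open>f 1\<close>.\<close>
  have "f x \<noteq> f 0" "f 1 = (f x + f 0) / (f x - f 0)" if "x \<in> F" "x \<noteq> 0" for x
    using SD[of x 0] inj[of x 0] that by auto
  from this[of 1] this[of 2]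
  have "f 1 \<noteq> f 0" "f 2 \<noteq> f 0"
    "(f 1 + f 0) / (f 1 - f 0) = (f 2 + f 0) / (f 2 - f 0)"
    by auto
  then have "2 * f 0 * f 1 = 2 * f 0 * f 2"
    by (simp add: frac_eq_eq) (auto simp: algebra_simps)
  then show False
    using c inj[of 1 2] by simp
qed

lemma map_one [simp]: "f 1 = 1"
  using SD[of 1 0] inj[of 1 0] by simp

lemma map_eq_zero_iff: "x \<in> F \<Longrightarrow> f x = 0 \<longleftrightarrow> x = 0"
  using inj[of x 0] by auto

text \<open>The SD equations for \<open>x\<close>, \<open>y\<close> and for \<open>x / y\<close>,
  \<open>1\<close> have the same left side, and \<open>u \<mapsto> (u + 1) / (u - 1)\<close> is
  injective.\<close>

lemma map_divide:
  assumes "x \<in> F" "y \<in> F"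
  shows "f (x / y) = f x / f y"
\<comment> \<open>For \<open>y = 0\<close> both quotients are \<open>0\<close> by the convention on
  division.\<close>
proof (cases "y = 0 \<or> x = y")
  case True
  then show ?thesis
    using assms map_eq_zero_iff by auto
next
  case False
  define t where "t = x / y"
  have t: "t \<in> F" "t \<noteq> 1"
    using assms False by (auto simp: t_def closed)
  have "(x + y) / (x - y) = (t + 1) / (t - 1)"
    using False by (simp add: t_def field_simps)
  then have "(f x + f y) / (f x - f y) = (f t + 1) / (f t - 1)"
    using SD[of x y] SD[of t 1] assms t False by simp
  moreover have "f x \<noteq> f y" "f t \<noteq> 1" "f y \<noteq> 0"
    using inj[of x y] inj[of t 1] map_eq_zero_iff[of y] assms t False by auto
  ultimately have "2 * (f t * f y) = 2 * f x"
    by (simp add: frac_eq_eq) (simp add: algebra_simps)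
  then show ?thesis
    using \<open>f y \<noteq> 0\<close> by (simp add: t_def field_simps)
qed

lemma map_mult:
  assumes "x \<in> F" "y \<in> F"
  shows "f (x * y) = f x * f y"
  using map_divide[of x "1 / y"] map_divide[of 1 y] assms by (simp add: closed)

lemma map_power: "x \<in> F \<Longrightarrow> f (x ^ n) = f x ^ n"
proof -
  assume x: "x \<in> F"
  have "x ^ n \<in> F \<and> f (x ^ n) = f x ^ n"
    by (induction n) (auto simp: x closed map_mult)
  then show ?thesis by simp
qed

lemma map_minus_one: "f (- 1) = - 1"
proof -
  have "f (- 1) * f (- 1) = 1"
    using map_mult[of "- 1" "- 1"] closed by simp
  moreover have "f (- 1) \<noteq> 1"
    using inj[of "- 1" 1] closed by simp
  ultimately show ?thesis
    by (simp add: square_eq_1_iff)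
qed

lemma map_minus: "x \<in> F \<Longrightarrow> f (- x) = - f x"
  using map_mult[of "- 1" x] map_minus_one closed by simp

text \<open>Multiplicativity splits the left side of the SD equation; clearing denominators leaves a
  form whose case \<open>y = 1\<close> is the recurrence.\<close>

lemma map_add:
  assumes "x \<in> F" "y \<in> F" "x \<noteq> y"
  shows "f (x + y) * (f x - f y) = f (x - y) * (f x + f y)"
proof -
  have "f (x + y) / f (x - y) = (f x + f y) / (f x - f y)"
    using SD[of x y] map_divide[of "x + y" "x - y"] assms closed by simp
  moreover have "f (x - y) \<noteq> 0" "f x - f y \<noteq> 0"
    using map_eq_zero_iff[of "x - y"] inj[of x y] assms closed by auto
  ultimately show ?thesis
    by (simp add: frac_eq_eq mult.commute)
qed

section \<open>The value at 2\<close>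

lemma map_two [simp]: "f 2 = 2"
proof -
  define a where "a = f 2"
  define b c where "b = f 3" and "c = f 5"
  have a: "a \<noteq> 0" "a \<noteq> 1"
    using inj[of 2 0] inj[of 2 1] by (auto simp: a_def)
  have 3: "b * (a - 1) = a + 1"
    using map_add[of 2 1] by (simp add: a_def b_def)
  have 4: "f 4 = a * a"
    using map_mult[of 2 2] by (simp add: a_def)
  have "c * (a * a - 1) = b * (a * a + 1)"
    using map_add[of 4 1] 4 by (simp add: b_def c_def)
  \<comment> \<open>Multiplying by \<open>a - 1\<close> eliminates \<open>b\<close>.\<close>
  then have "(a + 1) * (c * (a - 1) ^ 2) = (a + 1) * (a * a + 1)"
    using 3 by Groebner_Basis.algebra
  moreover have "a + 1 \<noteq> 0"
    using inj[of 2 "- 1"] map_minus_one closed by (auto simp: a_def add_eq_0_iff2)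
  ultimately have 5: "c * (a - 1) ^ 2 = a * a + 1"
    by simp
  have 6: "f 6 = a * b"
    using map_mult[of 2 3] by (simp add: a_def b_def)
  have "a * b * (c - 1) = a * a * (c + 1)"
    using map_add[of 5 1] 4 6 by (simp add: c_def)
  then have "b * (c - 1) = a * (c + 1)"
    using a by (simp add: mult.assoc)
  \<comment> \<open>One factor \<open>a - 1\<close> serves to eliminate \<open>b\<close> and two to
    eliminate \<open>c\<close>, leaving an equation in \<open>a\<close> alone.\<close>
  then have "b * (c - 1) * (a - 1) ^ 3 = a * (c + 1) * (a - 1) ^ 3"
    by simp
  moreover have "b * (c - 1) * (a - 1) ^ 3 = (b * (a - 1)) * (c * (a - 1) ^ 2 - (a - 1) ^ 2)"
    "a * (c + 1) * (a - 1) ^ 3 = a * (a - 1) * (c * (a - 1) ^ 2 + (a - 1) ^ 2)"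
    by Groebner_Basis.algebra+
  ultimately have "(a + 1) * (a * a + 1 - (a - 1) ^ 2) = a * (a - 1) * (a * a + 1 + (a - 1) ^ 2)"
    by (simp only: 3 5)
  moreover have "a * (a - 1) * (a * a + 1 + (a - 1) ^ 2) - (a + 1) * (a * a + 1 - (a - 1) ^ 2) =
      2 * a * ((a - 2) * (a ^ 2 + 1))"
    by Groebner_Basis.algebra
  ultimately have "2 * a * ((a - 2) * (a ^ 2 + 1)) = 0"
    by simp
  then have "a = 2 \<or> a ^ 2 = - 1"
    using a by (auto simp: add_eq_0_iff2)
  \<comment> \<open>The norm argument treats the real and complex cases at once.\<close>
  moreover have False if "a ^ 2 = - 1"
  proof -
    have "norm a ^ 2 = 1"
      using that by (metis norm_minus_cancel norm_one norm_power)
    then have norm_a: "norm a = 1"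
      by (metis abs_norm_cancel abs_square_eq_1)
    have half: "(1 / 2) \<in> F" "norm (f (1 / 2)) = 1"
      using norm_a map_divide[of 1 2] closed by (auto simp: a_def norm_divide)
    have pow: "(1 / 2) ^ n \<in> F" for n
      by (induction n) (auto intro!: closed_divide)
    have "(\<lambda>n. (1 / 2 :: 'a) ^ n) \<longlonglongrightarrow> 0"
      by (rule LIMSEQ_power_zero) (simp add: norm_divide)
    then have "(\<lambda>n. f ((1 / 2) ^ n)) \<longlonglongrightarrow> f 0"
      using pow by (intro continuous_on_tendsto_compose[OF continuous]) auto
    then have "(\<lambda>n. norm (f ((1 / 2) ^ n))) \<longlonglongrightarrow> 0"
      using tendsto_norm_zero by simp
    moreover have "norm (f ((1 / 2) ^ n)) = 1" for n
      using map_power[OF half(1), of n] half(2) by (simp add: norm_power)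
    ultimately show False
      by (simp add: LIMSEQ_const_iff)
  qed
  ultimately show ?thesis
    by (auto simp: a_def)
qed

section \<open>Rational numbers and density\<close>

lemma map_of_nat: "f (of_nat n) = of_nat n"
proof (induction n rule: less_induct)
  case (less n)
  \<comment> \<open>The recurrence for \<open>n\<close> compares \<open>n - 1\<close> with
    \<open>1\<close>, which must differ, so \<open>2\<close> is a base case.\<close>
  consider "n = 0" | "n = 1" | "n = 2" | m where "n = m + 3"
    by (metis less_2_cases le_add_diff_inverse2 not_less
        numeral_3_eq_3 One_nat_def Suc_leI le_neq_implies_less numeral_2_eq_2)
  then show ?case
  proof cases
    case (4 m)
    have "f (of_nat (m + 2)) = of_nat (m + 2)" "f (of_nat (m + 1)) = of_nat (m + 1)"
      using less.IH[of "m + 2"] less.IH[of "m + 1"] 4 by linarith+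
    moreover have "(of_nat (m + 2) :: 'a) \<noteq> of_nat 1"
      unfolding of_nat_eq_iff by simp
    then have "(of_nat (m + 2) :: 'a) \<noteq> 1" by simp
    moreover have "of_nat (m + 2) + 1 = (of_nat n :: 'a)"
      "of_nat (m + 2) - 1 = (of_nat (m + 1) :: 'a)"
      using 4 by auto
    ultimately have "f (of_nat n) * of_nat (m + 1) = of_nat (m + 1) * of_nat n"
      using map_add[of "of_nat (m + 2)" 1] closed_of_nat[of "m + 2"] closed_one
      by (simp del: of_nat_add)
    moreover have "(of_nat (m + 1) :: 'a) \<noteq> 0"
      unfolding of_nat_eq_0_iff by simp
    ultimately show ?thesis
      by (metis mult.commute mult_cancel_left)
  qed auto
qed

lemma map_Rats: "x \<in> \<rat> \<Longrightarrow> f x = x"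
proof (induction rule: Rats_cases')
  case (1 a b)
  have "of_int c \<in> F \<and> f (of_int c) = of_int c" for c
    by (cases c rule: int_cases2) (auto simp: map_of_nat map_minus closed)
  then show ?case
    using 1 map_divide by simp
qed

lemma eq_id_if_dense:
  assumes "D \<subseteq> F" "closure D = UNIV" "\<And>x. x \<in> D \<Longrightarrow> f x = x" "x \<in> F"
  shows "f x = x"
proof -
  obtain q where q: "\<And>n. q n \<in> D" "q \<longlonglongrightarrow> x"
    using assms(2) closure_sequential[of x D] by auto
  then have "(\<lambda>n. f (q n)) \<longlonglongrightarrow> f x"
    using assms by (intro continuous_on_tendsto_compose[OF continuous] always_eventually) auto
  then show ?thesis
    using q assms(3) LIMSEQ_unique by auto
qed

end

lemma continuous_SD_map_if_SD_map_on:
  "\<lbrakk>is_subfield F; SD_map_on F f; continuous_on F f\<rbrakk> \<Longrightarrow> continuous_SD_map F f"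
  unfolding SD_map_on_def by (intro continuous_SD_map.intro) auto

section \<open>Conjugation and the Gaussian rationals\<close>

lemma continuous_SD_map_cnj:
  assumes "continuous_SD_map F f"
  shows "continuous_SD_map F (\<lambda>z. cnj (f z))"
proof -
  interpret continuous_SD_map F f by fact
  show ?thesis
    by (intro continuous_SD_map.intro is_subfield continuous_on_cnj continuous)
      (auto simp: SD inj)
qed

lemma closure_gaussian_rationals: "closure gaussian_rationals = UNIV"
proof -
  have "z \<in> closure gaussian_rationals" for z
  proof -
    have "Re z \<in> closure \<rat>" "Im z \<in> closure \<rat>"
      by (simp_all add: Rats_closure_real)
    then obtain p q where pq: "\<And>n. p n \<in> \<rat>" "p \<longlonglongrightarrow> Re z" "\<And>n. q n \<in> \<rat>" "q \<longlonglongrightarrow> Im z"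
      unfolding closure_sequential by blast
    have rat: "of_real r \<in> (\<rat> :: complex set)" if "r \<in> \<rat>" for r
      using that by (auto elim!: Rats_cases)
    define w where "w = (\<lambda>n. complex_of_real (p n) + complex_of_real (q n) * \<i>)"
    have "w n \<in> gaussian_rationals" for n
      using pq rat unfolding w_def gaussian_rationals_def by blast
    moreover have "w \<longlonglongrightarrow> of_real (Re z) + of_real (Im z) * \<i>"
      unfolding w_def by (intro tendsto_intros pq)
    moreover have "of_real (Re z) + of_real (Im z) * \<i> = z"
      by (simp add: complex_eq_iff)
    ultimately show ?thesis
      unfolding closure_sequential by auto
  qed
  then show ?thesis by auto
qed

lemma map_gaussian_rationals:
  assumes "continuous_SD_map F f" and "gaussian_rationals \<subseteq> F" and f_ii: "f \<i> = \<i>"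
    and z: "z \<in> gaussian_rationals"
  shows "f z = z"
proof -
  interpret continuous_SD_map F f by fact
  have ii: "\<i> \<in> F"
    using assms(2) unfolding gaussian_rationals_def by force
  have pm: "f w = w \<or> f w = - w" if w: "w \<in> gaussian_rationals" for w
  proof -
    obtain r s where rs: "r \<in> \<rat>" "s \<in> \<rat>" "w = r + s * \<i>"
      using w unfolding gaussian_rationals_def by blast
    have F: "r \<in> F" "s * \<i> \<in> F" "r - s * \<i> \<in> F" "r + s * \<i> \<in> F"
      using rs closed_Rats ii closed by auto
    have si: "f (s * \<i>) = s * \<i>"
      using map_mult[of s \<i>] map_Rats rs closed_Rats ii f_ii by simp
    show ?thesis
    \<comment> \<open>The SD equation for \<open>r\<close> and \<open>s * \<i>\<close> requires them
      to be distinct.\<close>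
    proof (cases "r = s * \<i>")
      case True
      then have "w = 2 * r"
        using rs by simp
      then show ?thesis
        using rs map_Rats by simp
    next
      case False
      have "f (r + s * \<i>) * f (r - s * \<i>) = f (r ^ 2 + s ^ 2)"
        using map_mult[of "r + s * \<i>" "r - s * \<i>"] F
        by (simp add: algebra_simps power2_eq_square)
      also have "\<dots> = (r + s * \<i>) * (r - s * \<i>)"
        using map_Rats[of "r ^ 2 + s ^ 2"] rs by (simp add: algebra_simps power2_eq_square)
      finally have prod: "f w * f (r - s * \<i>) = w * (r - s * \<i>)"
        using rs by simp
      have quot: "f w * (r - s * \<i>) = f (r - s * \<i>) * w"
        using map_add[OF F(1,2) False] si map_Rats rs by simp
      \<comment> \<open>Multiplying the second equation by \<open>u\<close> and inserting the first
        eliminates \<open>v\<close>.\<close>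
      have "c * (u ^ 2 - w ^ 2) = 0" if "u * v = w * c" "u * c = v * w" for u v c :: complex
        using that by Groebner_Basis.algebra
      from this[OF prod quot] have "(r - s * \<i>) * (f w ^ 2 - w ^ 2) = 0" .
      then show ?thesis
        using False by (simp add: power2_eq_iff)
    qed
  qed
  have "z + 1 \<in> gaussian_rationals" "z - 1 \<in> gaussian_rationals"
  proof -
    obtain r s where rs: "r \<in> \<rat>" "s \<in> \<rat>" "z = r + s * \<i>"
      using z unfolding gaussian_rationals_def by blast
    have "r + 1 \<in> \<rat>" "z + 1 = (r + 1) + s * \<i>" "r - 1 \<in> \<rat>" "z - 1 = (r - 1) + s * \<i>"
      using rs by auto
    then show "z + 1 \<in> gaussian_rationals" "z - 1 \<in> gaussian_rationals"
      using rs(2) unfolding gaussian_rationals_def by blast+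
  qed
  note neighbours = pm[OF this(1)] pm[OF this(2)]
  show ?thesis
  proof (rule ccontr)
    assume neq: "f z \<noteq> z"
    then have minus: "f z = - z"
      using pm z by blast
    have "z \<noteq> 1" "z \<noteq> 0" "z \<noteq> \<i>" "z \<noteq> - \<i>"
      using neq f_ii map_minus[OF ii] by auto
    have "f (z + 1) * (f z - 1) = f (z - 1) * (f z + 1)"
      using map_add[of z 1] z assms(2) \<open>z \<noteq> 1\<close> by auto
    \<comment> \<open>Equal signs at the two neighbours give the first alternative, opposite signs
      the second.\<close>
    then have "(z + 1) ^ 2 = (z - 1) ^ 2 \<or> (z + 1) ^ 2 = - ((z - 1) ^ 2)"
      using neighbours unfolding minus by (elim disjE; Groebner_Basis.algebra)
    then have "4 * z = 0 \<or> 2 * ((z + \<i>) * (z - \<i>)) = 0"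
      by (auto simp: power2_eq_square algebra_simps)
    then show False
      using \<open>z \<noteq> 0\<close> \<open>z \<noteq> \<i>\<close> \<open>z \<noteq> - \<i>\<close> by (auto simp: add_eq_0_iff2)
  qed
qed

lemma complex_SD_map_eq_id:
  assumes "continuous_SD_map F f" "gaussian_rationals \<subseteq> F" "f \<i> = \<i>" "z \<in> F"
  shows "f z = z"
  using continuous_SD_map.eq_id_if_dense[OF assms(1,2) closure_gaussian_rationals _ assms(4)]
    map_gaussian_rationals[OF assms(1-3)] by blast

theorem theorem1p3:
  shows "(\<forall>(F :: real set) f.
            is_subfield F \<and> SD_map_on F f \<and> continuous_on F f
            \<longrightarrow> (\<forall>x\<in>F. f x = x)) \<and>
         (\<forall>(F :: complex set) f.
            is_subfield F \<and> gaussian_rationals \<subseteq> F \<and> SD_map_on F f \<and> continuous_on F f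
            \<longrightarrow> (\<forall>z\<in>F. f z = z) \<or> (\<forall>z\<in>F. f z = cnj z))"
proof (intro conjI allI impI)
  fix F :: "real set" and f
  assume "is_subfield F \<and> SD_map_on F f \<and> continuous_on F f"
  then interpret continuous_SD_map F f
    using continuous_SD_map_if_SD_map_on by blast
  show "\<forall>x\<in>F. f x = x"
    using eq_id_if_dense[of \<rat>] closed_Rats map_Rats Rats_closure_real by blast
next
  fix F :: "complex set" and f
  assume *: "is_subfield F \<and> gaussian_rationals \<subseteq> F \<and> SD_map_on F f \<and> continuous_on F f"
  then have f: "continuous_SD_map F f"
    using continuous_SD_map_if_SD_map_on by blast
  then interpret continuous_SD_map F f .
  have "\<i> \<in> F"
    using * unfolding gaussian_rationals_def by force
  then have "f \<i> ^ 2 = \<i> ^ 2"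
    using map_power[of \<i> 2] map_minus_one by simp
  then have "f \<i> = \<i> \<or> f \<i> = - \<i>"
    by (simp only: power2_eq_iff)
  then consider "f \<i> = \<i>" | "cnj (f \<i>) = \<i>"
    by auto
  then show "(\<forall>z\<in>F. f z = z) \<or> (\<forall>z\<in>F. f z = cnj z)"
  proof cases
    case 1
    then show ?thesis
      using complex_SD_map_eq_id[OF f] * by blast
  next
    case 2
    then have "cnj (f z) = z" if "z \<in> F" for z
      using complex_SD_map_eq_id[OF continuous_SD_map_cnj[OF f]] * that by blast
    then show ?thesis
      by (metis complex_cnj_cnj)
  qed
qed

end
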